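(* Let $N,K,L$ be positive integers with $K/2\le L\le K$ and $N\ge K$, and consider the $(N,K,L)$-CCDN. Let $R^*(M)$ be its optimal transmission rate under the restriction of uncoded placement at cache size $M$, and let $R_{\text{new}}(M)$, $0\le M\le \lceil K/L\rceil N/K$, be the achievable rate-memory trade-off defined in the context. Then for all $M\in[0,\lceil K/L\rceil N/K]$, $$R_{\text{new}}(M)\le \tfrac54\,R^*(M).$$
   Context: The $(N,K,L)$-CCDN (multi-access coded caching problem): a central server holds $N$ files, each of size 1 unit ($F$ bits, $F$ sufficiently large; arbitrary $F$-bit strings). There are $K$ caches, each of size $M$ units, and $K$ users; user $k$ has access to the $L$ consecutive caches $k,k+1,\dots,k+L-1$ (indices cyclically modulo $K$). In the placement phase the caches are filled without knowledge of the requests; placement is uncoded if each file may be split into parts and each cache stores some individual parts, with no coding across parts. In the delivery phase each user $k$ requests one file $d_k\in\{1,\dots,N\}$, and the server, knowing all requests, broadcasts an error-free message to all users; each user must recover its requested file from this message and the content of the $L$ caches it accesses. $R^*(M)$ is the minimum (infimum), over all uncoded placements and all delivery schemes, of the worst-case (over request patterns) size, in units, of the server message. Achievable trade-off $R_{\text{new}}$ for $L\ge K/2$: at the corner points, $$R_{\text{new}}(0)=K,\qquad R_{\text{new}}(N/K)=\frac{1}{2K}\sum_{\mathbf b\in\mathcal B}\min\{2(K-L)-\widehat{\mathbf b},\;K\},\qquad R_{\text{new}}(\lceil K/L\rceil N/K)=0,$$ where $\mathcal B$ is the set of pairs $\mathbf b=(b_2,b_1)$ of non-negative integers with $b_1+b_2=K-L-1$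 and $\widehat{\mathbf b}=\max\{b_1,b_2\}$ (if $L=K$ then $\mathcal B=\emptyset$, the sum is $0$, and the last two corner points coincide). Between consecutive corner points $R_{\text{new}}$ is defined by linear interpolation (memory sharing). *)

theory Defs
  imports Complex_Main "HOL-Library.FuncSet"
begin

text \<open>
  The (N,K,L)-CCDN. Files, caches and users are numbered from 0; user \<open>k\<close> accesses the caches
  \<open>(k + j) mod K\<close> for \<open>j < L\<close>. A file is an arbitrary bit string of length \<open>F\<close>, and sizes in
  units are numbers of bits divided by \<open>F\<close>.
\<close>

definition libraries :: "nat \<Rightarrow> nat \<Rightarrow> (nat \<Rightarrow> bool list) set" where
  "libraries N F = {..<N} \<rightarrow>\<^sub>E {w. length w = F}"

definition requests :: "nat \<Rightarrow> nat \<Rightarrow> (nat \<Rightarrow> nat) set" where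
  "requests N K = {..<K} \<rightarrow>\<^sub>E {..<N}"

text \<open>
  Splitting files into parts and letting each cache store some of the parts, uncoded, amounts to
  choosing for cache \<open>k\<close> a set \<open>Z k\<close> of bit positions, \<open>(n, i)\<close> being bit \<open>i\<close> of file \<open>n\<close>. The
  choice depends neither on the requests nor on the file contents.
\<close>

definition uncoded_placement ::
  "nat \<Rightarrow> nat \<Rightarrow> nat \<Rightarrow> real \<Rightarrow> (nat \<Rightarrow> (nat \<times> nat) set) \<Rightarrow> bool" where
  "uncoded_placement N K F M Z \<longleftrightarrow>
     (\<forall>k<K. Z k \<subseteq> {..<N} \<times> {..<F} \<and> real (card (Z k)) \<le> M * real F)"

definition cache_content ::
  "(nat \<Rightarrow> (nat \<times> nat) set) \<Rightarrow> (nat \<Rightarrow> bool list) \<Rightarrow> nat \<Rightarrow> (nat \<times> nat \<Rightarrow> bool option)" where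
  "cache_content Z W k = (\<lambda>(n, i). if (n, i) \<in> Z k then Some (W n ! i) else None)"

definition user_view ::
  "nat \<Rightarrow> nat \<Rightarrow> (nat \<Rightarrow> (nat \<times> nat) set) \<Rightarrow> (nat \<Rightarrow> bool list) \<Rightarrow> nat
     \<Rightarrow> (nat \<times> nat \<Rightarrow> bool option) list" where
  "user_view K L Z W k = map (\<lambda>j. cache_content Z W ((k + j) mod K)) [0..<L]"

text \<open>
  For the request pattern \<open>d\<close> the server broadcasts the \<open>len d\<close> bits \<open>enc d W\<close>; user \<open>k\<close>
  decodes with a function that may depend on the placement, on \<open>d\<close> and on \<open>k\<close>, but not on \<open>W\<close>.
\<close>

definition delivery_scheme ::
  "nat \<Rightarrow> nat \<Rightarrow> nat \<Rightarrow> nat \<Rightarrow> (nat \<Rightarrow> (nat \<times> nat) set) \<Rightarrow> ((nat \<Rightarrow> nat) \<Rightarrow> nat)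
     \<Rightarrow> ((nat \<Rightarrow> nat) \<Rightarrow> (nat \<Rightarrow> bool list) \<Rightarrow> bool list) \<Rightarrow> bool" where
  "delivery_scheme N K L F Z len enc \<longleftrightarrow>
     (\<forall>d\<in>requests N K.
        (\<forall>W\<in>libraries N F. length (enc d W) = len d) \<and>
        (\<forall>k<K. \<exists>dec. \<forall>W\<in>libraries N F. dec (enc d W) (user_view K L Z W k) = W (d k)))"

text \<open>
  The infimum also ranges over the file length \<open>F\<close>. This agrees with taking \<open>F\<close> large: a
  scheme for \<open>F\<close> applied blockwise gives one of the same rate for every multiple of \<open>F\<close>.
\<close>

definition R_star :: "nat \<Rightarrow> nat \<Rightarrow> nat \<Rightarrow> real \<Rightarrow> real" where
  "R_star N K L M =
     Inf {real (Max (len ` requests N K)) / real F | F Z len enc.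
            F > 0 \<and> uncoded_placement N K F M Z \<and> delivery_scheme N K L F Z len enc}"

text \<open>Pairs \<open>(b\<^sub>2, b\<^sub>1)\<close>. The sum condition is written without subtraction, so that the set is
  empty for \<open>L = K\<close>.\<close>

definition index_pairs :: "nat \<Rightarrow> nat \<Rightarrow> (nat \<times> nat) set" where
  "index_pairs K L = {(b2, b1). b1 + b2 + 1 + L = K}"

definition R_corner :: "nat \<Rightarrow> nat \<Rightarrow> real" where
  "R_corner K L =
     1 / (2 * real K) *
     (\<Sum>(b2, b1)\<in>index_pairs K L.
        min (2 * (real K - real L) - real (max b1 b2)) (real K))"

definition interpolate :: "real \<times> real \<Rightarrow> real \<times> real \<Rightarrow> real \<Rightarrow> real" where
  "interpolate = (\<lambda>(x0, y0) (x1, y1) x. y0 + (y1 - y0) * (x - x0) / (x1 - x0))"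

text \<open>For \<open>L = K\<close> the last two corner points coincide, and the second branch concerns only values
  of \<open>M\<close> beyond the range of the trade-off.\<close>

definition R_new :: "nat \<Rightarrow> nat \<Rightarrow> nat \<Rightarrow> real \<Rightarrow> real" where
  "R_new N K L M =
     (let M1 = real N / real K;
          M2 = of_int \<lceil>real K / real L\<rceil> * real N / real K
      in if M \<le> M1 then interpolate (0, real K) (M1, R_corner K L) M
         else interpolate (M1, R_corner K L) (M2, 0) M)"

end

theory Submission
  imports Defs "HOL-Number_Theory.Cong"
begin

text \<open>
  For distinct requests, let the users decode one after the other in the cyclic order
  \<open>u, u + 1, \<dots>\<close>. The bits of the \<open>j\<close>-th file that lie in none of the \<open>L + j\<close> caches seen so far
  are determined by the message alone, so the message is at least as long as their total number.
  Averaging over \<open>u\<close> and over the requests \<open>k \<mapsto> (k + v) mod N\<close>, a bit stored in \<open>t\<close> caches has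
  weight \<open>K\<^sup>2\<close> for \<open>t = 0\<close>, at least \<open>s (s + 1) / 2\<close> with \<open>s = K - L\<close> for \<open>t = 1\<close>, and at least
  \<open>0\<close> beyond. Bounding these weights from below by the two lines through consecutive points gives
  a convex lower bound on the rate with the same breakpoints as \<open>R_new\<close>. Bounding the
  minimum by its first argument, the corner value is at most \<open>(5 s\<^sup>2 + 2 s + 1) / (8 K)\<close>, hence at
  most \<open>5/4\<close> times the lower bound \<open>s (s + 1) / (2 K)\<close>.
\<close>

section \<open>Counting messages along one cyclic decoding order\<close>

lemma bij_betw_add_mod:
  fixes a n :: nat
  shows "bij_betw (\<lambda>v. (a + v) mod n) {..<n} {..<n}"
proof (cases "n = 0")
  case False
  have "inj_on (\<lambda>v. (a + v) mod n) {..<n}"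
  proof (rule inj_onI)
    fix v w assume "v \<in> {..<n}" "w \<in> {..<n}" "(a + v) mod n = (a + w) mod n"
    then have "[v = w] (mod n)"
      by (metis cong_add_lcancel_nat cong_def)
    with \<open>v \<in> {..<n}\<close> \<open>w \<in> {..<n}\<close> show "v = w"
      by (simp add: cong_def)
  qed
  moreover have "(\<lambda>v. (a + v) mod n) ` {..<n} \<subseteq> {..<n}"
    using False by auto
  ultimately show ?thesis
    by (simp add: bij_betw_def endo_inj_surj)
qed (simp add: bij_betw_def)

text \<open>A fooling-set argument: let the unseen bits vary freely and fix all other bits to
  \<open>False\<close>. Decodability forces distinct choices to give distinct messages, so there are
  at least 2 to the number of unseen bits among the messages of length \<open>len d\<close>.\<close>

lemma acyclic_bound:
  fixes u :: nat
  assumes Z: "uncoded_placement N K F M Z"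
    and scheme: "delivery_scheme N K L F Z len enc"
    and d: "d \<in> requests N K" and inj: "inj_on d {..<K}"
  shows "(\<Sum>j<K. card {i \<in> {..<F}. \<forall>m<L + j. (d ((u + j) mod K), i) \<notin> Z ((u + m) mod K)})
           \<le> len d"
proof -
  define B where "B = (SIGMA j:{..<K}. {i \<in> {..<F}. \<forall>m<L + j.
    (d ((u + j) mod K), i) \<notin> Z ((u + m) mod K)})"
  \<comment> \<open>A pair \<open>(j, i)\<close> names bit \<open>i\<close> of the file requested at
    position \<open>j\<close> of the order, and \<open>lib X\<close> is the library whose
    \<open>True\<close> bits are exactly those named by \<open>X\<close>.\<close>
  define lib where
    "lib X = (\<lambda>n\<in>{..<N}. map (\<lambda>i. \<exists>j. (j, i) \<in> X \<and> n = d ((u + j) mod K)) [0..<F])"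
    for X :: "(nat \<times> nat) set"
  have finB: "finite B"
    by (auto simp: B_def)
  have lib: "lib X \<in> libraries N F" for X
    by (auto simp: lib_def libraries_def)
  have lib_nth: "lib X n ! i \<longleftrightarrow> (\<exists>j. (j, i) \<in> X \<and> n = d ((u + j) mod K))"
    if "n < N" "i < F" for X n i
    using that by (simp add: lib_def)
  have user_inj: "j = j'" if "d ((u + j) mod K) = d ((u + j') mod K)" "j < K" "j' < K" for j j'
  proof -
    have "(u + j) mod K = (u + j') mod K"
      using inj_onD[OF inj that(1)] that by simp
    then show ?thesis
      using inj_onD[OF bij_betw_imp_inj_on[OF bij_betw_add_mod[of u K]], of j j'] that by simp
  qed
  have dN: "d k < N" if "k < K" for k
    using d that by (auto simp: requests_def)
  have injB: "inj_on (\<lambda>X. enc d (lib X)) (Pow B)"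
  proof (rule inj_onI)
    fix X Y assume X: "X \<in> Pow B" and Y: "Y \<in> Pow B" and eq: "enc d (lib X) = enc d (lib Y)"
    \<comment> \<open>Induction along the decoding order: if \<open>X\<close> and \<open>Y\<close>
      agree before position \<open>j\<close>, the user there sees equal cache contents besides the
      equal messages, and so decodes the same file from both libraries.\<close>
    have agree: "j < K \<longrightarrow> (\<forall>i. (j, i) \<in> X \<longleftrightarrow> (j, i) \<in> Y)" for j
    proof (induction j rule: less_induct)
      case (less j)
      show ?case
      proof (intro impI allI)
        fix i assume j: "j < K"
        define k where "k = (u + j) mod K"
        have k: "k < K" using j by (simp add: k_def)
        \<comment> \<open>A \<open>True\<close> bit in an accessed cache belongs to an earlier
          position: for \<open>j'\<close> at or after \<open>j\<close>, the cache
          \<open>k + l\<close> is among the first \<open>L + j'\<close> caches of the order, which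
          elements of \<open>B\<close> avoid. Stated for \<open>X'\<close> and \<open>Y'\<close> so
          that it serves in both directions.\<close>
        have known: "\<exists>j'. (j', i) \<in> Y' \<and> n = d ((u + j') mod K)"
          if known_X: "\<exists>j'. (j', i) \<in> X' \<and> n = d ((u + j') mod K)" "X' \<subseteq> B" "l < L"
            "(n, i) \<in> Z ((k + l) mod K)"
            "\<And>j' i. j' < j \<Longrightarrow> (j', i) \<in> X' \<Longrightarrow> (j', i) \<in> Y'"
          for X' Y' n i l
        proof -
          obtain j' where j': "(j', i) \<in> X'" "n = d ((u + j') mod K)"
            using known_X(1) by blast
          have "j' < j"
          proof (rule ccontr)
            assume "\<not> j' < j"
            then have "j + l < L + j'" using known_X(3) by simp
            moreover have "(k + l) mod K = (u + (j + l)) mod K"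
              by (simp add: k_def mod_add_left_eq add.assoc)
            ultimately show False
              using j' known_X(2,4) by (auto simp: B_def)
          qed
          with j' known_X(5) show ?thesis by blast
        qed
        have XY: "(j', i) \<in> X \<longleftrightarrow> (j', i) \<in> Y" if "j' < j" for j' i
          using less that j by auto
        have content: "cache_content Z (lib X) ((k + l) mod K) = cache_content Z (lib Y) ((k + l) mod K)"
          if l: "l < L" for l
        proof (rule ext)
          fix b :: "nat \<times> nat"
          obtain n i where b: "b = (n, i)" by fastforce
          show "cache_content Z (lib X) ((k + l) mod K) b
              = cache_content Z (lib Y) ((k + l) mod K) b"
          proof (cases "(n, i) \<in> Z ((k + l) mod K)")
            case True
            have "(k + l) mod K < K" using k by simp
            then have "n < N" "i < F"
              using Z True unfolding uncoded_placement_def by blast+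
            moreover have "(\<exists>j. (j, i) \<in> X \<and> n = d ((u + j) mod K))
              \<longleftrightarrow> (\<exists>j. (j, i) \<in> Y \<and> n = d ((u + j) mod K))"
              using known[of i X n l Y] known[of i Y n l X] X Y XY l True by auto
            ultimately show ?thesis
              by (simp add: b cache_content_def lib_nth)
          qed (simp add: b cache_content_def)
        qed
        then have view: "user_view K L Z (lib X) k = user_view K L Z (lib Y) k"
          by (simp add: user_view_def)
        obtain dec where dec:
          "\<And>W. W \<in> libraries N F \<Longrightarrow> dec (enc d W) (user_view K L Z W k) = W (d k)"
          using scheme d k unfolding delivery_scheme_def by blast
        have dk: "lib X (d k) = lib Y (d k)"
          using dec[OF lib[of X]] dec[OF lib[of Y]] view eq by simp
        \<comment> \<open>Requests are distinct, so the decoded file carries bits of position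
          \<open>j\<close> only and reveals this slice of \<open>X'\<close>.\<close>
        have "(j, i) \<in> X' \<longleftrightarrow> lib X' (d k) ! i" if X': "X' \<subseteq> B" "i < F" for X'
        proof
          assume "lib X' (d k) ! i"
          then obtain j' where j': "(j', i) \<in> X'" "d k = d ((u + j') mod K)"
            using lib_nth[OF dN[OF k] X'(2)] by blast
          then have "j' < K" using X' by (auto simp: B_def)
          then have "j = j'"
            using user_inj[of j j'] j' j by (simp add: k_def)
          with j' show "(j, i) \<in> X'" by simp
        qed (use lib_nth[OF dN[OF k] X'(2)] in \<open>auto simp: k_def\<close>)
        moreover have "i < F" if "(j, i) \<in> X \<or> (j, i) \<in> Y"
          using that X Y by (auto simp: B_def)
        ultimately show "(j, i) \<in> X \<longleftrightarrow> (j, i) \<in> Y"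
          using dk X Y by (metis PowD)
      qed
    qed
    show "X = Y"
      using agree X Y by (auto simp: B_def)
  qed
  have "(\<lambda>X. enc d (lib X)) ` Pow B \<subseteq> {xs. set xs \<subseteq> UNIV \<and> length xs = len d}"
    using scheme d lib by (auto simp: delivery_scheme_def)
  then have "card (Pow B) \<le> card {xs :: bool list. set xs \<subseteq> UNIV \<and> length xs = len d}"
    by (intro card_inj_on_le[OF injB] finite_lists_length_eq) simp_all
  then have "2 ^ card B \<le> (2 :: nat) ^ len d"
    using card_lists_length_eq[of "UNIV :: bool set" "len d"] finB by (simp add: card_Pow)
  then have "card B \<le> len d"
    by simp
  then show ?thesis
    by (simp add: B_def)
qed

section \<open>Weights of storage patterns\<close>

text \<open>For a bit stored in exactly the caches \<open>S\<close>, each pair of a start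
  \<open>u\<close> and a position \<open>j\<close> is counted at which the bit, if its file is the
  one decoded there, is still unseen.\<close>

definition weight :: "nat \<Rightarrow> nat \<Rightarrow> nat set \<Rightarrow> nat" where
  "weight K L S = (\<Sum>u<K. \<Sum>j<K. of_bool (\<forall>m<L + j. (u + m) mod K \<notin> S))"

lemma weight_empty: "weight K L {} = K\<^sup>2"
  by (simp add: weight_def power2_eq_square)

text \<open>A cyclic window of \<open>L + j\<close> caches contains \<open>p\<close> for at most
  \<open>L + j\<close> starts, so at least \<open>K - (L + j)\<close> starts avoid it. Summing over
  \<open>j\<close> gives a triangular number; the factor 2 avoids a division.\<close>

lemma weight_singleton:
  assumes "L \<le> K"
  shows "(K - L) * (K - L + 1) \<le> 2 * weight K L {p}"
proof -
  have count: "K - (L + j) \<le> card {u \<in> {..<K}. \<forall>m<L + j. (u + m) mod K \<noteq> p}" for j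
  proof -
    \<comment> \<open>The only start that reaches \<open>p\<close> after \<open>m\<close> steps is
      \<open>p - m\<close> modulo \<open>K\<close>, written with \<open>(K - 1) * m\<close> to avoid
      truncated subtraction.\<close>
    have "{u \<in> {..<K}. \<exists>m<L + j. (u + m) mod K = p}
        \<subseteq> (\<lambda>m. (p + (K - 1) * m) mod K) ` {..<L + j}"
    proof
      fix u assume "u \<in> {u \<in> {..<K}. \<exists>m<L + j. (u + m) mod K = p}"
      then obtain m where m: "u < K" "m < L + j" "(u + m) mod K = p" by auto
      have "(p + (K - 1) * m) mod K = (u + (m + (K - 1) * m)) mod K"
        by (simp add: m(3)[symmetric] mod_add_left_eq add.assoc)
      also have "m + (K - 1) * m = K * m"
        using m(1) by (cases K) auto
      finally show "u \<in> (\<lambda>m. (p + (K - 1) * m) mod K) ` {..<L + j}"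
        using m by auto
    qed
    from surj_card_le[OF finite_lessThan this]
    have "card {u \<in> {..<K}. \<exists>m<L + j. (u + m) mod K = p} \<le> L + j"
      by simp
    moreover have "{u \<in> {..<K}. \<forall>m<L + j. (u + m) mod K \<noteq> p}
        = {..<K} - {u \<in> {..<K}. \<exists>m<L + j. (u + m) mod K = p}" by auto
    ultimately show ?thesis
      using diff_card_le_card_Diff[of "{u \<in> {..<K}. \<exists>m<L + j. (u + m) mod K = p}" "{..<K}"] by simp
  qed
  have "(K - L) * (K - L + 1) = 2 * (\<Sum>j<K - L. K - L - j)"
  proof -
    have "(\<Sum>j<s. s - j) * 2 = s * (s + 1)" for s :: nat
      by (induction s) (simp_all add: sum.lessThan_Suc_shift del: sum.lessThan_Suc)
    then show ?thesis by (metis mult.commute)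
  qed
  also have "(\<Sum>j<K - L. K - L - j) \<le> (\<Sum>j<K. K - (L + j))"
    by (rule order.trans[OF _ sum_mono2[of _ "{..<K - L}"]]) auto
  also have "\<dots> \<le> (\<Sum>j<K. card {u \<in> {..<K}. \<forall>m<L + j. (u + m) mod K \<noteq> p})"
    by (rule sum_mono) (rule count)
  also have "\<dots> = weight K L {p}"
    unfolding weight_def by (subst sum.swap) (simp add: Int_def)
  finally show ?thesis by simp
qed

section \<open>Averaging over starts and shifted requests\<close>

lemma sum_rotate:
  "(\<Sum>a\<in>A. \<Sum>b\<in>B. \<Sum>c\<in>C. f a b c) = (\<Sum>b\<in>B. \<Sum>c\<in>C. \<Sum>a\<in>A. f a b c)"
  by (subst sum.swap) (intro sum.cong refl sum.swap)

text \<open>Sum \<open>acyclic_bound\<close> over the \<open>K\<close> starts and the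
  \<open>N\<close> shifted requests. Every bit is then counted once for each pair
  \<open>(u, j)\<close> at which it is unseen, that is, with its weight.\<close>

lemma rate_ge_average_weight:
  assumes NK: "K \<le> N"
    and Z: "uncoded_placement N K F M Z"
    and scheme: "delivery_scheme N K L F Z len enc"
  shows "(\<Sum>b\<in>{..<N} \<times> {..<F}. weight K L {k. k < K \<and> b \<in> Z k})
           \<le> N * K * Max (len ` requests N K)"
proof -
  define d where "d v = (\<lambda>k\<in>{..<K}. (k + v) mod N)" for v
  define free where "free u j n = {i \<in> {..<F}. \<forall>m<L + j. (n, i) \<notin> Z ((u + m) mod K)}" for u j n
  have fin: "finite (requests N K)"
    by (simp add: requests_def finite_PiE)
  have d: "d v \<in> requests N K" for v
    using NK by (auto simp: d_def requests_def)
  have inj: "inj_on (d v) {..<K}" for v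
  proof (rule inj_onI)
    fix a b assume "a \<in> {..<K}" "b \<in> {..<K}" "d v a = d v b"
    then show "a = b"
      using inj_onD[OF bij_betw_imp_inj_on[OF bij_betw_add_mod[of v N]], of a b] NK
      by (simp add: d_def add.commute)
  qed
  \<comment> \<open>For a fixed position of a fixed order, the shifts \<open>v\<close> run through
    every file exactly once.\<close>
  have shift: "(\<Sum>v<N. card (free u j (d v ((u + j) mod K)))) = (\<Sum>n<N. card (free u j n))"
    if "j < K" for u j
    using sum.reindex_bij_betw[OF bij_betw_add_mod[of "(u + j) mod K" N],
        of "\<lambda>n. card (free u j n)"] that by (simp add: d_def)
  have free: "card (free u j n)
      = (\<Sum>i<F. of_bool (\<forall>m<L + j. (u + m) mod K \<notin> {k. k < K \<and> (n, i) \<in> Z k}))"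
    if "j < K" for u j n
  proof -
    have "free u j n = {i \<in> {..<F}. \<forall>m<L + j. (u + m) mod K \<notin> {k. k < K \<and> (n, i) \<in> Z k}}"
      using that by (auto simp: free_def)
    then show ?thesis by (simp add: Int_def)
  qed
  have "(\<Sum>b\<in>{..<N} \<times> {..<F}. weight K L {k. k < K \<and> b \<in> Z k})
      = (\<Sum>n<N. \<Sum>i<F. \<Sum>u<K. \<Sum>j<K.
          of_bool (\<forall>m<L + j. (u + m) mod K \<notin> {k. k < K \<and> (n, i) \<in> Z k}))"
    by (simp only: weight_def sum.cartesian_product')
  also have "\<dots> = (\<Sum>n<N. \<Sum>u<K. \<Sum>j<K. \<Sum>i<F.
          of_bool (\<forall>m<L + j. (u + m) mod K \<notin> {k. k < K \<and> (n, i) \<in> Z k}))"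
    by (intro sum.cong refl sum_rotate)
  also have "\<dots> = (\<Sum>n<N. \<Sum>u<K. \<Sum>j<K. card (free u j n))"
    by (intro sum.cong refl) (simp only: free lessThan_iff)
  also have "\<dots> = (\<Sum>u<K. \<Sum>j<K. \<Sum>n<N. card (free u j n))"
    by (rule sum_rotate)
  also have "\<dots> = (\<Sum>u<K. \<Sum>j<K. \<Sum>v<N. card (free u j (d v ((u + j) mod K))))"
    by (rule sum.cong[OF refl], rule sum.cong[OF refl]) (simp only: shift lessThan_iff)
  also have "\<dots> = (\<Sum>u<K. \<Sum>v<N. \<Sum>j<K. card (free u j (d v ((u + j) mod K))))"
    by (intro sum.cong refl sum.swap)
  also have "\<dots> \<le> (\<Sum>u<K. \<Sum>v<N. len (d v))"
    by (intro sum_mono) (use acyclic_bound[OF Z scheme d inj] in \<open>simp add: free_def\<close>)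
  also have "\<dots> \<le> (\<Sum>u<K. \<Sum>v<N. Max (len ` requests N K))"
    by (intro sum_mono Max_ge) (use fin d in auto)
  finally show ?thesis by (simp add: mult_ac)
qed

section \<open>Linear lower bounds on the optimal rate\<close>

lemma sum_stored_le:
  assumes "uncoded_placement N K F M Z"
  shows "real (\<Sum>b\<in>{..<N} \<times> {..<F}. card {k. k < K \<and> b \<in> Z k}) \<le> real K * (M * real F)"
proof -
  have "(\<Sum>b\<in>{..<N} \<times> {..<F}. card {k. k < K \<and> b \<in> Z k})
      = (\<Sum>b\<in>{..<N} \<times> {..<F}. \<Sum>k<K. of_bool (b \<in> Z k))"
    by (simp add: Int_def)
  also have "\<dots> = (\<Sum>k<K. \<Sum>b\<in>{..<N} \<times> {..<F}. of_bool (b \<in> Z k))"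
    by (rule sum.swap)
  also have "\<dots> = (\<Sum>k<K. card (Z k))"
  proof (rule sum.cong[OF refl])
    fix k assume "k \<in> {..<K}"
    then have "({..<N} \<times> {..<F}) \<inter> Z k = Z k"
      using assms by (auto simp: uncoded_placement_def)
    then show "(\<Sum>b\<in>{..<N} \<times> {..<F}. of_bool (b \<in> Z k)) = card (Z k)" by simp
  qed
  also have "real \<dots> \<le> (\<Sum>k<K. M * real F)"
    unfolding of_nat_sum using assms by (intro sum_mono) (auto simp: uncoded_placement_def)
  finally show ?thesis by simp
qed

text \<open>An affine bound on weights in terms of \<open>card S\<close> survives summation over all
  bits, where the cardinalities add up to at most the total memory \<open>K * M * F\<close>. The
  sign of \<open>\<beta>\<close> makes this bound usable; dividing by \<open>N * K * F\<close> gives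
  the rate.\<close>

lemma rate_ge_line:
  fixes \<alpha> \<beta> :: real
  assumes "0 < K" "K \<le> N" "0 < F" "0 \<le> \<beta>"
    and Z: "uncoded_placement N K F M Z"
    and scheme: "delivery_scheme N K L F Z len enc"
    and line: "\<And>S. S \<subseteq> {..<K} \<Longrightarrow> \<alpha> - \<beta> * real (card S) \<le> real (weight K L S)"
  shows "\<alpha> / real K - \<beta> * M / real N \<le> real (Max (len ` requests N K)) / real F"
proof -
  let ?S = "\<lambda>b. {k. k < K \<and> b \<in> Z k}" and ?B = "{..<N} \<times> {..<F}"
  have "\<alpha> * (real N * real F) - \<beta> * (real K * (M * real F))
      \<le> \<alpha> * (real N * real F) - \<beta> * real (\<Sum>b\<in>?B. card (?S b))"
    using mult_left_mono[OF sum_stored_le[OF Z] \<open>0 \<le> \<beta>\<close>] by simp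
  also have "\<dots> = (\<Sum>b\<in>?B. \<alpha> - \<beta> * real (card (?S b)))"
    by (simp add: sum_subtractf sum_distrib_left mult_ac)
  also have "\<dots> \<le> (\<Sum>b\<in>?B. real (weight K L (?S b)))"
    by (intro sum_mono line) auto
  also have "\<dots> \<le> real (N * K * Max (len ` requests N K))"
    using rate_ge_average_weight[OF \<open>K \<le> N\<close> Z scheme] by (simp flip: of_nat_sum of_nat_mult)
  finally show ?thesis
    using assms(1-3) by (simp add: field_simps)
qed

text \<open>Empty caches, one-bit files and sending every requested bit show that the infimum in
  \<open>R_star\<close> is over a nonempty set, as \<open>cInf_greatest\<close> requires.\<close>

lemma trivial_scheme:
  assumes "0 \<le> M"
  shows "uncoded_placement N K 1 M (\<lambda>_. {})"
    and "delivery_scheme N K L 1 (\<lambda>_. {}) (\<lambda>_. K) (\<lambda>d W. map (\<lambda>k. W (d k) ! 0) [0..<K])"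
proof -
  show "uncoded_placement N K 1 M (\<lambda>_. {})"
    using assms by (simp add: uncoded_placement_def)
  have "[W (d k) ! 0] = W (d k)"
    if "d \<in> requests N K" "k < K" "W \<in> libraries N 1" for d k W
  proof -
    have "length (W (d k)) = 1"
      using that by (auto simp: requests_def libraries_def PiE_def Pi_def)
    then show ?thesis by (cases "W (d k)") auto
  qed
  then show "delivery_scheme N K L 1 (\<lambda>_. {}) (\<lambda>_. K) (\<lambda>d W. map (\<lambda>k. W (d k) ! 0) [0..<K])"
    unfolding delivery_scheme_def
  proof (intro ballI conjI allI impI, goal_cases)
    case (2 d k)
    then show ?case
      by (intro exI[of _ "\<lambda>x _. [x ! k]"]) simp
  qed simp
qed

lemma R_star_ge_line:
  fixes \<alpha> \<beta> :: real
  assumes "0 < K" "K \<le> N" "0 \<le> M" "0 \<le> \<beta>"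
    and line: "\<And>S. S \<subseteq> {..<K} \<Longrightarrow> \<alpha> - \<beta> * real (card S) \<le> real (weight K L S)"
  shows "\<alpha> / real K - \<beta> * M / real N \<le> R_star N K L M"
  unfolding R_star_def
proof (rule cInf_greatest)
  show "{real (Max (len ` requests N K)) / real F | F Z len enc.
      F > 0 \<and> uncoded_placement N K F M Z \<and> delivery_scheme N K L F Z len enc} \<noteq> {}"
    using trivial_scheme[OF \<open>0 \<le> M\<close>, of N K] by blast
qed (use rate_ge_line[OF assms(1,2) _ assms(4) _ _ line] in blast)

text \<open>The last three assumptions compare the line with the weight bounds at cardinalities 0, 1
  and 2. Beyond 2 the line stays nonpositive because it does not increase.\<close>

lemma weight_ge_line:
  fixes \<alpha> \<beta> :: real and S :: "nat set"
  assumes "L \<le> K" "S \<subseteq> {..<K}" "0 \<le> \<beta>"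
    and "\<alpha> \<le> (real K)\<^sup>2" "\<alpha> - \<beta> \<le> (real K - real L) * (real K - real L + 1) / 2"
    and "\<alpha> \<le> 2 * \<beta>"
  shows "\<alpha> - \<beta> * real (card S) \<le> real (weight K L S)"
proof -
  have "finite S" using assms(2) finite_subset by blast
  consider "card S = 0" | "card S = 1" | "2 \<le> card S" by linarith
  then show ?thesis
  proof cases
    case 1
    with \<open>finite S\<close> assms(4) show ?thesis by (simp add: weight_empty)
  next
    case 2
    then obtain p where "S = {p}" by (auto simp: card_1_singleton_iff)
    moreover have "real ((K - L) * (K - L + 1)) \<le> real (2 * weight K L {p})"
      using weight_singleton[OF assms(1)] by (simp only: of_nat_le_iff)
    moreover have "real ((K - L) * (K - L + 1)) = (real K - real L) * (real K - real L + 1)"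
      using assms(1) by (simp only: of_nat_mult of_nat_add of_nat_diff of_nat_1)
    ultimately show ?thesis using assms(5) by simp
  next
    case 3
    then have "\<beta> * 2 \<le> \<beta> * real (card S)"
      using assms(3) by (intro mult_left_mono) auto
    with assms(6) show ?thesis by (simp add: order.trans[OF _ of_nat_0_le_iff])
  qed
qed

section \<open>Estimating the corner value\<close>

text \<open>Induction in steps of two: removing both end terms, each \<open>t + 1\<close>, leaves
  the sum for \<open>t\<close> with every term raised by 1. Both sides grow by the same amount, so
  odd \<open>s\<close> gives equality and even \<open>s\<close> a slack of 1.\<close>

lemma sum_max_ge: "3 * s\<^sup>2 \<le> 4 * (\<Sum>b<s. max b (s - 1 - b)) + 2 * s + (1 :: nat)"
proof (induction s rule: less_induct)
  case (less s)
  have ends: "(\<Sum>b<t + 2. f b) = f 0 + (\<Sum>b<t. f (Suc b)) + f (t + 1)"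
    for f :: "nat \<Rightarrow> nat" and t
    by (simp only: add_2_eq_Suc' sum.lessThan_Suc_shift[of f "Suc t"]
        sum.lessThan_Suc[of "\<lambda>b. f (Suc b)" t]) simp
  consider "s = 0" | "s = 1" | t where "s = t + 2"
    by (metis One_nat_def add_2_eq_Suc' not0_implies_Suc)
  then show ?case
  proof cases
    case 3
    have "(\<Sum>b<s. max b (s - 1 - b)) = (t + 1) + (\<Sum>b<t. max b (t - 1 - b) + 1) + (t + 1)"
    proof -
      have "(\<Sum>b<s. max b (s - 1 - b)) = (t + 1) + (\<Sum>b<t. max (Suc b) (t - b)) + (t + 1)"
        by (simp only: 3 ends) simp
      also have "(\<Sum>b<t. max (Suc b) (t - b)) = (\<Sum>b<t. max b (t - 1 - b) + 1)"
        by (rule sum.cong) auto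
      finally show ?thesis .
    qed
    then show ?thesis
      using less[of t] 3 by (simp add: sum_Suc power2_eq_square algebra_simps)
  qed auto
qed

lemma R_corner_le:
  assumes "0 < K" "L \<le> K"
  shows "R_corner K L \<le> 5 / 4 * ((real K - real L) * (real K - real L + 1) / 2 / real K)"
proof -
  define s where "s = K - L"
  have s: "real s = real K - real L" using assms by (simp add: s_def)
  have "index_pairs K L = (\<lambda>b. (b, s - 1 - b)) ` {..<s}"
    using assms by (force simp: index_pairs_def s_def image_iff)
  moreover have "inj_on (\<lambda>b. (b, s - 1 - b)) {..<s}" by (auto simp: inj_on_def)
  ultimately have "(\<Sum>(b2, b1)\<in>index_pairs K L.
        min (2 * (real K - real L) - real (max b1 b2)) (real K))
      = (\<Sum>b<s. min (2 * real s - real (max (s - 1 - b) b)) (real K))"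
    by (simp add: sum.reindex s)
  also have "\<dots> \<le> (\<Sum>b<s. 2 * real s - real (max b (s - 1 - b)))"
    by (intro sum_mono) (simp add: max.commute)
  also have "\<dots> = 2 * (real s)\<^sup>2 - real (\<Sum>b<s. max b (s - 1 - b))"
    by (simp add: sum_subtractf power2_eq_square)
  \<comment> \<open>By \<open>sum_max_ge\<close> the left side is at most (5 s^2 + 2 s + 1) / 4, and
    the claim becomes 1 <= 3 s; hence the separate case \<open>s = 0\<close>.\<close>
  also have "\<dots> \<le> 5 / 4 * (real s * (real s + 1))"
  proof (cases "s = 0")
    case False
    have "real (3 * s\<^sup>2) \<le> real (4 * (\<Sum>b<s. max b (s - 1 - b)) + 2 * s + 1)"
      using sum_max_ge of_nat_le_iff by blast
    moreover have "1 \<le> real s" using False by simp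
    ultimately show ?thesis by (simp add: algebra_simps power2_eq_square)
  qed simp
  finally show ?thesis
    unfolding R_corner_def using assms(1) by (simp add: s field_simps)
qed

section \<open>Comparison on the two memory intervals\<close>

theorem mainTheorem9:
  fixes N K L :: nat and M :: real
  assumes "N > 0" and "K > 0" and "L > 0"
    and "real K / 2 \<le> real L" and "L \<le> K" and "N \<ge> K"
    and "0 \<le> M" and "M \<le> of_int \<lceil>real K / real L\<rceil> * real N / real K"
  shows "R_new N K L M \<le> 5 / 4 * R_star N K L M"
proof -
  define s where "s = real K - real L"
  \<comment> \<open>\<open>c\<close> is the bound on the weight of a bit stored once, and
    \<open>x\<close> is the memory in units of N/K, which moves the breakpoint to 1.\<close>
  define c where "c = s * (s + 1) / 2"
  define x where "x = M * real K / real N"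
  have s: "0 \<le> s" "s + 1 \<le> real K" using assms by (auto simp: s_def)
  have c0: "0 \<le> c" using s by (simp add: c_def)
  have c: "c \<le> (real K - real L) * (real K - real L + 1) / 2"
    by (simp add: c_def s_def)
  have c2: "2 * c \<le> (real K)\<^sup>2"
  proof -
    have "2 * c = s * (s + 1)" by (simp add: c_def)
    also have "\<dots> \<le> real K * real K"
      using s by (intro mult_mono) auto
    finally show ?thesis by (simp add: power2_eq_square)
  qed
  have corner: "R_corner K L \<le> 5 / 4 * (c / real K)"
    using R_corner_le[of K L] assms by (simp add: c_def s_def)
  \<comment> \<open>The line through (0, K^2) and (1, \<open>c\<close>): \<open>\<alpha>\<close> is
    K^2 and \<open>\<beta>\<close> is K^2 - \<open>c\<close>. It is nonpositive at 2 by
    \<open>c2\<close>.\<close>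
  have low: "real K * (1 - x) + c / real K * x \<le> R_star N K L M"
  proof -
    have "(real K)\<^sup>2 / real K - ((real K)\<^sup>2 - c) * M / real N \<le> R_star N K L M"
      using assms c0 c2 c
      by (intro R_star_ge_line weight_ge_line) auto
    moreover have "(real K)\<^sup>2 / real K - ((real K)\<^sup>2 - c) * M / real N
        = real K * (1 - x) + c / real K * x"
      using assms by (simp add: x_def field_simps power2_eq_square)
    ultimately show ?thesis by simp
  qed
  \<comment> \<open>The line through (1, \<open>c\<close>) and (2, 0): \<open>\<alpha>\<close> is 2
    \<open>c\<close> and \<open>\<beta>\<close> is \<open>c\<close>. Here \<open>c2\<close> keeps it
    below K^2 at 0.\<close>
  have high: "c / real K * (2 - x) \<le> R_star N K L M"
  proof -
    have "2 * c / real K - c * M / real N \<le> R_star N K L M"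
      using assms c0 c2 c
      by (intro R_star_ge_line weight_ge_line) auto
    moreover have "2 * c / real K - c * M / real N = c / real K * (2 - x)"
      using assms by (simp add: x_def field_simps)
    ultimately show ?thesis by simp
  qed
  show ?thesis
  proof (cases "M \<le> real N / real K")
    case True
    then have x: "0 \<le> x" "x \<le> 1"
      using assms by (auto simp: x_def field_simps)
    have "R_new N K L M = real K * (1 - x) + R_corner K L * x"
      using True assms by (simp add: R_new_def interpolate_def x_def field_simps)
    also have "\<dots> \<le> 5 / 4 * (real K * (1 - x)) + 5 / 4 * (c / real K) * x"
      using x corner by (intro add_mono mult_right_mono) auto
    also have "\<dots> = 5 / 4 * (real K * (1 - x) + c / real K * x)"
      by (simp only: distrib_left mult.assoc)
    also have "\<dots> \<le> 5 / 4 * R_star N K L M"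
      using low by (rule mult_left_mono) simp
    finally show ?thesis .
  next
    case False
    \<comment> \<open>For \<open>L = K\<close> the range of \<open>M\<close> would end at N/K,
      contrary to this case; otherwise K/L lies in the interval from 1 exclusive to 2
      inclusive.\<close>
    have two: "\<lceil>real K / real L\<rceil> = 2"
    proof -
      have "L \<noteq> K" using False assms by auto
      then show ?thesis
        using assms by (intro ceiling_unique) (auto simp: field_simps)
    qed
    have x: "x \<le> 2"
      using assms two by (simp add: x_def field_simps)
    have "R_new N K L M = R_corner K L * (2 - x)"
      using False assms two by (simp add: R_new_def interpolate_def x_def field_simps)
    also have "\<dots> \<le> 5 / 4 * (c / real K) * (2 - x)"
      using x corner by (intro mult_right_mono) auto
    also have "\<dots> = 5 / 4 * (c / real K * (2 - x))"
      by (simp only: mult.assoc)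
    also have "\<dots> \<le> 5 / 4 * R_star N K L M"
      using high by (rule mult_left_mono) simp
    finally show ?thesis .
  qed
qed

end
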